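(* Let $n\ge1$, let $\alpha>0$, and let $\mathcal{D}$ be a probability distribution over $S_n$. If $\mathcal{D}$ is backwards $\alpha$-efficient, then $\mathrm{H}(\mathcal{D})\ge\left\lfloor \frac{n}{48\alpha}\right\rfloor$.
   Context: $[n]=\{1,\dots,n\}$ and $S_n$ is the set of permutations of $[n]$. A permutation $\pi\in S_n$ is viewed as the ordering $(\pi(1),\dots,\pi(n))$; for $I\subseteq[n]$, $\pi(I)=\{\pi(j):j\in I\}$ and $[i]=\{1,\dots,i\}$. A cost function over $[n]$ assigns a real number $c(x,Y)$ to every $Y\subseteq[n]$ and $x\in Y$; the total cost of $\pi$ is $c(\pi)=\sum_{i=1}^n c(\pi(i),\pi([i]))$. $\mathcal{D}$ is backwards $\alpha$-efficient if for every cost function $c$ such that $\mathbb{E}_{x\sim\mathcal{U}(Y)}[c(x,Y)]\le1$ for every nonempty $Y\subseteq[n]$ ($\mathcal{U}(Y)$ the uniform distribution on $Y$), we have $\mathbb{E}_{\pi\sim\mathcal{D}}[c(\pi)]\le\alpha n$. $\mathrm{H}(\mathcal{D})=-\sum_{\pi}\Pr_{\mathcal{D}}[\pi]\ln\Pr_{\mathcal{D}}[\pi]$ is the (natural-log) entropy of $\mathcal{D}$. *)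

theory Defs
  imports "HOL-Probability.Probability" "HOL-Combinatorics.Permutations"
begin

text \<open>
  A permutation of \<open>[n]\<close> is a function \<open>\<pi>\<close> with \<open>\<pi> permutes {1..n}\<close>, and a distribution over \<open>S\<^sub>n\<close>
  is a pmf supported on these. A cost function is a total function \<open>c\<close>, of which only the values
  \<open>c x Y\<close> with \<open>x \<in> Y \<subseteq> {1..n}\<close> are ever used; costs may be negative.
\<close>

definition total_cost :: "nat \<Rightarrow> (nat \<Rightarrow> nat set \<Rightarrow> real) \<Rightarrow> (nat \<Rightarrow> nat) \<Rightarrow> real" where
  "total_cost n c \<pi> = (\<Sum>i=1..n. c (\<pi> i) (\<pi> ` {1..i}))"

definition backwards_efficient :: "nat \<Rightarrow> real \<Rightarrow> (nat \<Rightarrow> nat) pmf \<Rightarrow> bool" where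
  "backwards_efficient n \<alpha> D \<longleftrightarrow>
     (\<forall>c :: nat \<Rightarrow> nat set \<Rightarrow> real.
        (\<forall>Y. Y \<subseteq> {1..n} \<and> Y \<noteq> {} \<longrightarrow> measure_pmf.expectation (pmf_of_set Y) (\<lambda>x. c x Y) \<le> 1) \<longrightarrow>
        measure_pmf.expectation D (total_cost n c) \<le> \<alpha> * real n)"

text \<open>The convention \<open>0 \<cdot> ln 0 = 0\<close> holds automatically.\<close>

definition perm_entropy :: "nat \<Rightarrow> (nat \<Rightarrow> nat) pmf \<Rightarrow> real" where
  "perm_entropy n D = - (\<Sum>\<pi> | \<pi> permutes {1..n}. pmf D \<pi> * ln (pmf D \<pi>))"

end

theory Submission imports Defs begin

text \<open>
  Let \<open>f i Y\<close> be the probability that the first \<open>i\<close> elements form the set \<open>Y\<close>, and let \<open>q i x Y\<close> be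
  the conditional probability that \<open>\<pi> i = x\<close> given this event. The cost function
  \<open>c x Y = |Y| \<cdot> q |Y| x Y\<close> is admissible, so efficiency gives
  \<open>(\<Sum>i. i \<cdot> E[q i]) \<le> \<alpha> n\<close>. By averaging over the upper half of the positions there is a window
  \<open>{N-k<..N}\<close> of length \<open>k = \<lfloor>n / (48 \<alpha>)\<rfloor>\<close> on which the \<open>E[q i]\<close> sum to at most \<open>1/3\<close>.

  Extend \<open>\<pi>[N]\<close> downwards by the Markov chain with kernel \<open>q\<close>: it has the same marginals \<open>f i\<close>,
  and a path of length \<open>k\<close> is determined by its endpoints up to \<open>k!\<close> choices, so that
  \<open>H(\<pi>[N-k]) \<ge> (\<Sum>i. E[- ln q i]) - ln k!\<close>, which is at least \<open>k\<close>. This estimate is obtained one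
  step at a time from Gibbs' inequality, with the potential
  \<open>E[ln F(\<pi>[i]) - ln (f i \<pi>[i])]\<close>, where \<open>F Y\<close> is the probability that \<open>Y \<subseteq> \<pi>[N]\<close>.
\<close>

section \<open>Gibbs' inequality and averaging over windows\<close>

text \<open>Pointwise \<open>ln t \<le> t - 1\<close>, averaged over \<open>p\<close>. The weight
  \<open>h\<close> is arbitrary positive, so its mass on the support stays in the bound; mass at
  most 1 makes the expectation nonpositive.\<close>

lemma expectation_ln_ratio_le:
  fixes p :: "'a pmf" and h :: "'a \<Rightarrow> real"
  assumes fin: "finite (set_pmf p)" and pos: "\<And>z. z \<in> set_pmf p \<Longrightarrow> h z > 0"
  shows "measure_pmf.expectation p (\<lambda>z. ln (h z / pmf p z)) \<le> sum h (set_pmf p) - 1"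
proof -
  have "measure_pmf.expectation p (\<lambda>z. ln (h z / pmf p z))
      = (\<Sum>z\<in>set_pmf p. ln (h z / pmf p z) * pmf p z)"
    by (rule integral_measure_pmf_real[OF fin]) auto
  also have "\<dots> \<le> (\<Sum>z\<in>set_pmf p. h z - pmf p z)"
  proof (rule sum_mono)
    fix z assume z: "z \<in> set_pmf p"
    hence pz: "pmf p z > 0" by (rule pmf_positive)
    have "ln (h z / pmf p z) \<le> h z / pmf p z - 1"
      using pos[OF z] pz by (intro ln_le_minus_one) simp
    hence "ln (h z / pmf p z) * pmf p z \<le> (h z / pmf p z - 1) * pmf p z"
      using pz by (intro mult_right_mono) auto
    also have "\<dots> = h z - pmf p z" using pz by (simp add: field_simps)
    finally show "ln (h z / pmf p z) * pmf p z \<le> h z - pmf p z" .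
  qed
  also have "\<dots> = sum h (set_pmf p) - 1"
    by (simp add: sum_subtractf sum_pmf_eq_1[OF fin])
  finally show ?thesis .
qed

text \<open>Positions in the upper half weigh at least \<open>n/2\<close>, so \<open>a\<close> sums
  to at most \<open>2 * \<alpha>\<close> over the windows there. If each of \<open>W\<close>
  disjoint windows had sum above \<open>1/3\<close>, then \<open>W \<le> 6 * \<alpha>\<close>, yet
  they fill the upper half up to fewer than \<open>k\<close> positions.\<close>

lemma exists_light_window:
  fixes a :: "nat \<Rightarrow> real"
  assumes nonneg: "\<And>i. a i \<ge> 0" and sum: "(\<Sum>i=1..n. real i * a i) \<le> \<alpha> * real n"
    and k: "k \<ge> 1" "real k * (48 * \<alpha>) \<le> real n" and \<alpha>: "\<alpha> \<ge> 1"
  shows "\<exists>N. k \<le> N \<and> N \<le> n \<and> (\<Sum>i\<in>{N-k<..N}. a i) \<le> 1 / 3"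
proof (rule ccontr)
  assume neg: "\<not> ?thesis"
  define h where "h = n div 2"
  define W where "W = (n - h) div k"
  have "real k * 48 \<le> real k * (48 * \<alpha>)" using \<alpha> by (intro mult_left_mono) auto
  hence kn: "48 * k \<le> n" using k by linarith
  have Wk: "W * k \<le> n - h" unfolding W_def by simp
  have "(n - h) mod k < k" using k by simp
  moreover have "W * k + (n - h) mod k = n - h" unfolding W_def by simp
  ultimately have Wk2: "n - h < W * k + k" by linarith
  \<comment> \<open>Window \<open>b\<close> covers the positions \<open>h+b*k+1\<close> to
    \<open>h+b*k+k\<close>, so it is the one ending at \<open>N = h+b*k+k\<close>.\<close>
  have win: "(\<Sum>l\<in>{b*k..<b*k+k}. a (h+1+l)) > 1/3" if "b < W" for b
  proof -
    have "Suc b * k \<le> W * k" using that by (intro mult_right_mono) auto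
    hence le: "h + b*k + k \<le> n" using Wk h_def by (simp add: algebra_simps)
    have "\<not> (\<Sum>i\<in>{h+b*k+k-k<..h+b*k+k}. a i) \<le> 1/3"
      using neg le by (metis le_add2)
    moreover have "(\<Sum>i\<in>{h+b*k+k-k<..h+b*k+k}. a i) = (\<Sum>l\<in>{b*k..<b*k+k}. a (h+1+l))"
      by (rule sum.reindex_bij_witness[of _ "\<lambda>l. h+1+l" "\<lambda>i. i-h-1"]) auto
    ultimately show ?thesis by linarith
  qed
  have "real W / 3 = (\<Sum>b<W. 1/3)" by simp
  also have "\<dots> \<le> (\<Sum>b<W. \<Sum>l\<in>{b*k..<b*k+k}. a (h+1+l))"
    by (rule sum_mono) (use win in force)
  also have "\<dots> = (\<Sum>l<W*k. a (h+1+l))" by (rule sum.nat_group)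
  finally have lower: "real W / 3 \<le> (\<Sum>l<W*k. a (h+1+l))" .
  have "real n / 2 * (\<Sum>l<W*k. a (h+1+l)) \<le> (\<Sum>l<W*k. real (h+1+l) * a (h+1+l))"
    unfolding sum_distrib_left
  proof (rule sum_mono)
    fix l
    have "real n / 2 \<le> real (h+1+l)" unfolding h_def by linarith
    thus "real n / 2 * a (h+1+l) \<le> real (h+1+l) * a (h+1+l)" by (intro mult_right_mono nonneg)
  qed
  also have "\<dots> = (\<Sum>i\<in>(\<lambda>l. h+1+l) ` {..<W*k}. real i * a i)"
    by (subst sum.reindex) (auto simp: inj_on_def)
  also have "\<dots> \<le> (\<Sum>i=1..n. real i * a i)"
    by (rule sum_mono2) (use Wk in \<open>auto simp: nonneg\<close>)
  finally have "real n / 2 * (\<Sum>l<W*k. a (h+1+l)) \<le> \<alpha> * real n" using sum by linarith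
  hence "(\<Sum>l<W*k. a (h+1+l)) \<le> 2 * \<alpha>" using kn k by (simp add: field_simps)
  hence "real W \<le> 6 * \<alpha>" using lower by linarith
  hence "real W * real k \<le> 6 * \<alpha> * real k" by (intro mult_right_mono) auto
  hence "8 * real (W * k) \<le> real n" using k(2) by (simp add: mult_ac)
  hence "8 * (W * k) \<le> n" by linarith
  \<comment> \<open>Here \<open>n - h \<ge> n/2\<close>, whereas
    \<open>W*k + k \<le> n/8 + n/48\<close>.\<close>
  thus False using Wk2 kn k h_def by linarith
qed

section \<open>Prefix laws of a random permutation\<close>

locale permutation_pmf =
  fixes n :: nat and D :: "(nat \<Rightarrow> nat) pmf"
  assumes support: "set_pmf D \<subseteq> {\<pi>. \<pi> permutes {1..n}}"
begin

abbreviation E :: "((nat \<Rightarrow> nat) \<Rightarrow> real) \<Rightarrow> real" where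
  "E \<equiv> measure_pmf.expectation D"

definition prefix_prob :: "nat \<Rightarrow> nat set \<Rightarrow> real" where
  "prefix_prob i Y = measure D {\<pi>. \<pi> ` {1..i} = Y}"

definition joint_prob :: "nat \<Rightarrow> nat \<Rightarrow> nat set \<Rightarrow> real" where
  "joint_prob i x Y = measure D {\<pi>. \<pi> i = x \<and> \<pi> ` {1..i} = Y}"

text \<open>Division by zero makes this \<open>0\<close> where \<open>prefix_prob i Y = 0\<close>,
  which keeps the cost built from it admissible on every \<open>Y\<close>.\<close>

definition last_prob :: "nat \<Rightarrow> nat \<Rightarrow> nat set \<Rightarrow> real" where
  "last_prob i x Y = joint_prob i x Y / prefix_prob i Y"

definition cover_prob :: "nat \<Rightarrow> nat set \<Rightarrow> real" where
  "cover_prob N Y = measure D {\<pi>. Y \<subseteq> \<pi> ` {1..N}}"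

text \<open>The second term averages to the entropy of the prefix of length \<open>i\<close>. The
  cover term is a correction that makes the value at \<open>i = N\<close> zero and lets a downward
  step be controlled by double counting.\<close>

definition potential :: "nat \<Rightarrow> nat \<Rightarrow> real" where
  "potential N i = E (\<lambda>\<pi>. ln (cover_prob N (\<pi> ` {1..i})) - ln (prefix_prob i (\<pi> ` {1..i})))"

lemma finite_support: "finite (set_pmf D)"
  using support finite_permutations[of "{1..n}"] finite_subset by blast

lemma integrable_D [simp]: "integrable (measure_pmf D) (h :: (nat \<Rightarrow> nat) \<Rightarrow> real)"
  by (rule integrable_measure_pmf_finite[OF finite_support])

lemma expectation_mono:
  assumes "\<And>\<pi>. \<pi> \<in> set_pmf D \<Longrightarrow> h \<pi> \<le> h' \<pi>"
  shows "E h \<le> E h'"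
  by (rule integral_mono_AE) (use assms in \<open>auto simp: AE_measure_pmf_iff\<close>)

lemma permutes_D: "\<pi> \<in> set_pmf D \<Longrightarrow> \<pi> permutes {1..n}"
  using support by auto

lemma inj_D: "\<pi> \<in> set_pmf D \<Longrightarrow> inj_on \<pi> A"
  using permutes_D permutes_inj_on by blast

lemma card_prefix: "\<pi> \<in> set_pmf D \<Longrightarrow> card (\<pi> ` {1..i}) = i"
  by (simp add: card_image inj_D)

lemma prefix_subset: "\<pi> \<in> set_pmf D \<Longrightarrow> i \<le> n \<Longrightarrow> \<pi> ` {1..i} \<subseteq> {1..n}"
  using permutes_image[OF permutes_D, of \<pi>] by fastforce

lemma measure_pos:
  assumes "\<pi> \<in> set_pmf D" "\<pi> \<in> A"
  shows "measure D A > 0"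
  using assms by (meson measure_pmf_posI)

lemma prefix_prob_pos: "\<pi> \<in> set_pmf D \<Longrightarrow> prefix_prob i (\<pi> ` {1..i}) > 0"
  unfolding prefix_prob_def by (rule measure_pos) auto

lemma joint_prob_pos: "\<pi> \<in> set_pmf D \<Longrightarrow> joint_prob i (\<pi> i) (\<pi> ` {1..i}) > 0"
  unfolding joint_prob_def by (rule measure_pos) auto

lemma cover_prob_pos: "\<pi> \<in> set_pmf D \<Longrightarrow> i \<le> N \<Longrightarrow> cover_prob N (\<pi> ` {1..i}) > 0"
  unfolding cover_prob_def by (rule measure_pos) auto

lemma sum_joint_prob:
  assumes "finite Y" "i \<ge> 1"
  shows "(\<Sum>x\<in>Y. joint_prob i x Y) = prefix_prob i Y"
proof -
  have "(\<Sum>x\<in>Y. joint_prob i x Y) = measure D (\<Union>x\<in>Y. {\<pi>. \<pi> i = x \<and> \<pi> ` {1..i} = Y})"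
    unfolding joint_prob_def
    by (rule measure_pmf.finite_measure_finite_Union[symmetric])
       (use assms in \<open>auto simp: disjoint_family_on_def\<close>)
  also have "(\<Union>x\<in>Y. {\<pi>. \<pi> i = x \<and> \<pi> ` {1..i} = Y}) = {\<pi>. \<pi> ` {1..i} = Y}"
    \<comment> \<open>\<open>i \<ge> 1\<close> forces \<open>\<pi> i\<close> into \<open>Y\<close>,
      so the union over \<open>x \<in> Y\<close> loses nothing.\<close>
    using assms(2) by (auto intro!: bexI[of _ i])
  finally show ?thesis by (simp add: prefix_prob_def)
qed

text \<open>Double counting: a set \<open>T\<close> of size \<open>N\<close> containing \<open>Y\<close> contains
  \<open>N - card Y\<close> of the sets \<open>insert x Y\<close> with \<open>x \<notin> Y\<close>.\<close>

lemma sum_cover_prob_insert: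
  assumes "N \<le> n" "Y \<subseteq> {1..n}"
  shows "(\<Sum>x\<in>{1..n} - Y. cover_prob N (insert x Y)) = (real N - real (card Y)) * cover_prob N Y"
proof -
  have finY: "finite Y" using assms finite_subset by blast
  have "(\<Sum>x\<in>{1..n} - Y. cover_prob N (insert x Y))
      = (\<Sum>x\<in>{1..n} - Y. E (indicator {\<pi>. insert x Y \<subseteq> \<pi> ` {1..N}}))"
    unfolding cover_prob_def by simp
  also have "\<dots> = E (\<lambda>\<pi>. \<Sum>x\<in>{1..n} - Y. indicator {\<pi>. insert x Y \<subseteq> \<pi> ` {1..N}} \<pi>)"
    by (rule Bochner_Integration.integral_sum[symmetric]) simp
  also have "\<dots> = E (\<lambda>\<pi>. (real N - real (card Y)) * indicator {\<pi>. Y \<subseteq> \<pi> ` {1..N}} \<pi>)"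
  proof (intro integral_cong_AE)
    have "(\<Sum>x\<in>{1..n} - Y. indicator {\<pi>. insert x Y \<subseteq> \<pi> ` {1..N}} \<pi>)
        = (real N - real (card Y)) * indicator {\<pi>. Y \<subseteq> \<pi> ` {1..N}} \<pi>"
      if \<pi>: "\<pi> \<in> set_pmf D" for \<pi>
    proof (cases "Y \<subseteq> \<pi> ` {1..N}")
      case True
      have "(\<Sum>x\<in>{1..n} - Y. indicator {\<pi>. insert x Y \<subseteq> \<pi> ` {1..N}} \<pi>)
          = (\<Sum>x\<in>{1..n} - Y. if x \<in> \<pi> ` {1..N} then 1 else (0::real))"
        using True by (intro sum.cong) (auto simp: indicator_def)
      also have "\<dots> = real (card (({1..n} - Y) \<inter> \<pi> ` {1..N}))"
        by (subst sum.inter_restrict[symmetric]) auto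
      also have "({1..n} - Y) \<inter> \<pi> ` {1..N} = \<pi> ` {1..N} - Y"
        using prefix_subset[OF \<pi> assms(1)] by blast
      also have "real (card (\<pi> ` {1..N} - Y)) = real N - real (card Y)"
        using True finY card_prefix[OF \<pi>, of N] card_mono[OF _ True]
        by (simp add: card_Diff_subset of_nat_diff)
      finally show ?thesis using True by simp
    qed (auto simp: indicator_def)
    thus "AE \<pi> in D. (\<Sum>x\<in>{1..n} - Y. indicator {\<pi>. insert x Y \<subseteq> \<pi> ` {1..N}} \<pi>)
        = (real N - real (card Y)) * indicator {\<pi>. Y \<subseteq> \<pi> ` {1..N}} \<pi>"
      by (simp add: AE_measure_pmf_iff)
  qed auto
  also have "\<dots> = (real N - real (card Y)) * cover_prob N Y"
    unfolding cover_prob_def by simp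
  finally show ?thesis .
qed

section \<open>The potential: value at the top, entropy bound, single step\<close>

text \<open>Prefixes of length \<open>N\<close> all have \<open>N\<close> elements by injectivity,
  so containment between two of them is equality.\<close>

lemma potential_top: "potential N N = 0"
proof -
  have "cover_prob N (\<pi> ` {1..N}) = prefix_prob N (\<pi> ` {1..N})" if \<pi>: "\<pi> \<in> set_pmf D" for \<pi>
    unfolding cover_prob_def prefix_prob_def
  proof (rule measure_pmf.finite_measure_eq_AE)
    have "\<pi> ` {1..N} = \<sigma> ` {1..N}" if "\<sigma> \<in> set_pmf D" "\<pi> ` {1..N} \<subseteq> \<sigma> ` {1..N}" for \<sigma>
      using that card_prefix[OF \<pi>, of N] card_prefix[of \<sigma> N]
      by (intro card_subset_eq) auto
    thus "AE \<sigma> in D. (\<sigma> \<in> {\<sigma>. \<pi> ` {1..N} \<subseteq> \<sigma> ` {1..N}}) = (\<sigma> \<in> {\<sigma>. \<sigma> ` {1..N} = \<pi> ` {1..N}})"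
      by (fastforce simp: AE_measure_pmf_iff)
  qed auto
  hence "potential N N = E (\<lambda>_. 0)"
    unfolding potential_def by (intro integral_cong_AE) (auto simp: AE_measure_pmf_iff)
  thus ?thesis by simp
qed

lemma perm_entropy_eq: "perm_entropy n D = E (\<lambda>\<pi>. - ln (pmf D \<pi>))"
proof -
  have "E (\<lambda>\<pi>. - ln (pmf D \<pi>)) = (\<Sum>\<pi> | \<pi> permutes {1..n}. - ln (pmf D \<pi>) * pmf D \<pi>)"
    by (rule integral_measure_pmf_real) (use support finite_permutations in auto)
  thus ?thesis unfolding perm_entropy_def by (simp add: sum_negf mult.commute)
qed

lemma perm_entropy_nonneg: "perm_entropy n D \<ge> 0"
  unfolding perm_entropy_eq
  by (rule integral_nonneg_AE) (auto simp: AE_measure_pmf_iff pmf_le_1 pmf_positive)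

text \<open>The cover logarithm is nonpositive, and the event of having the same prefix as
  \<open>\<pi>\<close> is at least as likely as \<open>\<pi>\<close> itself.\<close>

lemma potential_le_perm_entropy:
  assumes "i \<le> N"
  shows "potential N i \<le> perm_entropy n D"
  unfolding potential_def perm_entropy_eq
proof (rule expectation_mono)
  fix \<pi> assume \<pi>: "\<pi> \<in> set_pmf D"
  have "ln (cover_prob N (\<pi> ` {1..i})) \<le> 0"
    using cover_prob_pos[OF \<pi> assms] by (simp add: cover_prob_def)
  moreover have "pmf D \<pi> \<le> prefix_prob i (\<pi> ` {1..i})"
    unfolding prefix_prob_def pmf.rep_eq by (rule measure_pmf.finite_measure_mono) auto
  hence "ln (pmf D \<pi>) \<le> ln (prefix_prob i (\<pi> ` {1..i}))"
    using pmf_positive[OF \<pi>] by simp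
  ultimately show "ln (cover_prob N (\<pi> ` {1..i})) - ln (prefix_prob i (\<pi> ` {1..i})) \<le> - ln (pmf D \<pi>)"
    by linarith
qed

text \<open>Gibbs' inequality compares the law of the last element and the prefix of length
  \<open>i\<close> with this weight: draw the prefix \<open>Y\<close> of length \<open>i - 1\<close>
  from its law, then add \<open>x\<close> with weight
  \<open>cover_prob N (insert x Y) / (m * cover_prob N Y)\<close>. By double counting the total mass
  is 1.\<close>

lemma potential_step:
  assumes i: "1 \<le> i" "i \<le> N" "N \<le> n"
  shows "potential N i - E (\<lambda>\<pi>. ln (last_prob i (\<pi> i) (\<pi> ` {1..i}))) - ln (real (N - i + 1))
      \<le> potential N (i - 1)"
proof -
  \<comment> \<open>This is \<open>N - (i - 1)\<close>, the factor of the double count when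
    \<open>card Y = i - 1\<close>.\<close>
  define m where "m = real (N - i + 1)"
  define A where "A = (\<lambda>\<pi>::nat \<Rightarrow> nat. (\<pi> i, \<pi> ` {1..i}))"
  define p where "p = map_pmf A D"
  define h where "h = (\<lambda>(x, Y). prefix_prob (i-1) (Y - {x}) * cover_prob N Y
      / (m * cover_prob N (Y - {x})))"
  have m: "m > 0" unfolding m_def by simp
  have iN: "i - 1 \<le> N" using i by simp
  have prev: "\<pi> ` {1..i} - {\<pi> i} = \<pi> ` {1..i-1}" if "\<pi> \<in> set_pmf D" for \<pi>
  proof -
    have "{1..i-1} = {1..i} - {i}" using i by auto
    thus ?thesis using inj_on_image_set_diff[OF inj_D[OF that, of UNIV], of "{1..i}" "{i}"] by simp
  qed
  have pmf_p: "pmf p (x, Y) = joint_prob i x Y" for x Y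
    unfolding p_def joint_prob_def pmf_map by (rule arg_cong[of _ _ "measure D"]) (auto simp: A_def)
  have fin: "finite (set_pmf p)" unfolding p_def using finite_support by simp
  have hpos: "h z > 0" if z: "z \<in> set_pmf p" for z
  proof -
    obtain \<pi> where \<pi>: "\<pi> \<in> set_pmf D" "z = A \<pi>" using z by (auto simp: p_def)
    show ?thesis
      using prefix_prob_pos[OF \<pi>(1), of "i-1"] cover_prob_pos[OF \<pi>(1), of i N]
        cover_prob_pos[OF \<pi>(1) iN] i m prev[OF \<pi>(1)]
      by (simp add: \<pi>(2) A_def h_def)
  qed
  \<comment> \<open>On these shorter prefixes the cover probability is positive, so the denominators
    of \<open>h'\<close> cancel.\<close>
  define P where "P = (\<lambda>\<pi>. \<pi> ` {1..i-1}) ` set_pmf D"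
  define h' where "h' = (\<lambda>(Y, x). prefix_prob (i-1) Y * cover_prob N (insert x Y)
      / (m * cover_prob N Y))"
  have PD: "Y \<subseteq> {1..n} \<and> card Y = i - 1 \<and> cover_prob N Y > 0" if Y: "Y \<in> P" for Y
  proof -
    obtain \<pi> where \<pi>: "\<pi> \<in> set_pmf D" "Y = \<pi> ` {1..i-1}" using Y by (auto simp: P_def)
    show ?thesis
      unfolding \<pi>(2) using prefix_subset[OF \<pi>(1), of "i-1"] card_prefix[OF \<pi>(1), of "i-1"]
        cover_prob_pos[OF \<pi>(1) iN] i by linarith
  qed
  have finP: "finite P" unfolding P_def using finite_support by simp
  \<comment> \<open>\<open>h'\<close> is \<open>h\<close> in the coordinates shorter prefix and
    added element; pairs that do not come from the support only add nonnegative terms.\<close>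
  have "sum h (set_pmf p) \<le> sum h' (Sigma P (\<lambda>Y. {1..n} - Y))"
  proof (rule sum_le_included[where i = "\<lambda>(Y, x). (x, insert x Y)"])
    show "\<forall>z\<in>set_pmf p. \<exists>y\<in>Sigma P (\<lambda>Y. {1..n} - Y).
        (case y of (Y, x) \<Rightarrow> (x, insert x Y)) = z \<and> h z \<le> h' y"
    proof
      fix z assume "z \<in> set_pmf p"
      then obtain \<pi> where \<pi>: "\<pi> \<in> set_pmf D" "z = A \<pi>" by (auto simp: p_def)
      have ins: "insert (\<pi> i) (\<pi> ` {1..i-1}) = \<pi> ` {1..i}"
        using prev[OF \<pi>(1)] i by auto
      have "\<pi> i \<in> {1..n}" using prefix_subset[OF \<pi>(1), of i] i
        by (meson atLeastAtMost_iff image_subset_iff le_refl le_trans)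
      moreover have "\<pi> i \<notin> \<pi> ` {1..i-1}" using prev[OF \<pi>(1)] by blast
      ultimately show "\<exists>y\<in>Sigma P (\<lambda>Y. {1..n} - Y).
        (case y of (Y, x) \<Rightarrow> (x, insert x Y)) = z \<and> h z \<le> h' y"
        using \<pi> ins prev[OF \<pi>(1)]
        by (intro bexI[of _ "(\<pi> ` {1..i-1}, \<pi> i)"]) (auto simp: A_def h_def h'_def P_def)
    qed
  qed (use fin finP m in \<open>auto simp: h'_def prefix_prob_def cover_prob_def\<close>)
  also have "\<dots> = (\<Sum>Y\<in>P. \<Sum>x\<in>{1..n} - Y. h' (Y, x))"
    using finP by (subst sum.Sigma) auto
  also have "\<dots> = (\<Sum>Y\<in>P. prefix_prob (i-1) Y)"
  proof (rule sum.cong)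
    fix Y assume Y: "Y \<in> P"
    have "(\<Sum>x\<in>{1..n} - Y. h' (Y, x)) = prefix_prob (i-1) Y / (m * cover_prob N Y)
        * (\<Sum>x\<in>{1..n} - Y. cover_prob N (insert x Y))"
      unfolding h'_def by (simp add: sum_distrib_left)
    also have "(\<Sum>x\<in>{1..n} - Y. cover_prob N (insert x Y)) = m * cover_prob N Y"
      using sum_cover_prob_insert[of N Y] PD[OF Y] i by (simp add: m_def of_nat_diff)
    finally show "(\<Sum>x\<in>{1..n} - Y. h' (Y, x)) = prefix_prob (i-1) Y"
      using PD[OF Y] m by simp
  qed simp
  also have "\<dots> = (\<Sum>Y\<in>P. pmf (map_pmf (\<lambda>\<pi>. \<pi> ` {1..i-1}) D) Y)"
    unfolding prefix_prob_def pmf_map by (intro sum.cong arg_cong[of _ _ "measure D"]) auto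
  also have "\<dots> = 1"
    using finP by (intro sum_pmf_eq_1) (auto simp: P_def)
  finally have "sum h (set_pmf p) - 1 \<le> 0" by simp
  hence "measure_pmf.expectation p (\<lambda>z. ln (h z / pmf p z)) \<le> 0"
    using expectation_ln_ratio_le[of p h, OF fin hpos] by linarith
  hence le0: "E (\<lambda>\<pi>. ln (h (A \<pi>) / pmf p (A \<pi>))) \<le> 0"
    by (simp add: p_def)
  \<comment> \<open>Since \<open>joint_prob\<close> is \<open>last_prob\<close> times
    \<open>prefix_prob\<close>, the logarithm splits into the integrands of two potentials,
    \<open>ln last_prob\<close> and \<open>ln m\<close>.\<close>
  have "E (\<lambda>\<pi>. ln (h (A \<pi>) / pmf p (A \<pi>))) =
    E (\<lambda>\<pi>. (ln (cover_prob N (\<pi> ` {1..i})) - ln (prefix_prob i (\<pi> ` {1..i})))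
      - ln (last_prob i (\<pi> i) (\<pi> ` {1..i})) - ln m
      - (ln (cover_prob N (\<pi> ` {1..i-1})) - ln (prefix_prob (i-1) (\<pi> ` {1..i-1}))))"
  proof (intro integral_cong_AE)
    have "ln (h (A \<pi>) / pmf p (A \<pi>)) =
      (ln (cover_prob N (\<pi> ` {1..i})) - ln (prefix_prob i (\<pi> ` {1..i})))
      - ln (last_prob i (\<pi> i) (\<pi> ` {1..i})) - ln m
      - (ln (cover_prob N (\<pi> ` {1..i-1})) - ln (prefix_prob (i-1) (\<pi> ` {1..i-1})))"
      if \<pi>: "\<pi> \<in> set_pmf D" for \<pi>
      using prefix_prob_pos[OF \<pi>, of "i-1"] prefix_prob_pos[OF \<pi>, of i]
        cover_prob_pos[OF \<pi>, of i N] joint_prob_pos[OF \<pi>, of i]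
        cover_prob_pos[OF \<pi> iN] i m prev[OF \<pi>]
      by (simp add: A_def h_def pmf_p last_prob_def ln_div ln_mult)
    thus "AE \<pi> in D. ln (h (A \<pi>) / pmf p (A \<pi>)) =
      (ln (cover_prob N (\<pi> ` {1..i})) - ln (prefix_prob i (\<pi> ` {1..i})))
      - ln (last_prob i (\<pi> i) (\<pi> ` {1..i})) - ln m
      - (ln (cover_prob N (\<pi> ` {1..i-1})) - ln (prefix_prob (i-1) (\<pi> ` {1..i-1})))"
      by (simp add: AE_measure_pmf_iff)
  qed auto
  also have "\<dots> = potential N i - E (\<lambda>\<pi>. ln (last_prob i (\<pi> i) (\<pi> ` {1..i}))) - ln m
      - potential N (i - 1)"
    unfolding potential_def
    by (subst Bochner_Integration.integral_diff, simp, simp)+ simp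
  finally show ?thesis using le0 unfolding m_def by linarith
qed

section \<open>Linearising the logarithm and summing over a window\<close>

definition hit_prob :: "nat \<Rightarrow> real" where
  "hit_prob i = E (\<lambda>\<pi>. last_prob i (\<pi> i) (\<pi> ` {1..i}))"

lemma hit_prob_nonneg: "hit_prob i \<ge> 0"
  unfolding hit_prob_def last_prob_def joint_prob_def prefix_prob_def by simp

lemma potential_step_hit_prob:
  assumes i: "1 \<le> i" "i \<le> N" "N \<le> n" and k: "N < i + k"
  shows "potential N i + 2 - 3 * real k * hit_prob i \<le> potential N (i - 1)"
proof -
  define m where "m = real (N - i + 1)"
  have m: "m > 0" "m \<le> real k" using k i by (auto simp: m_def)
  have "E (\<lambda>\<pi>. ln (last_prob i (\<pi> i) (\<pi> ` {1..i})) + ln m + 2)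
      \<le> E (\<lambda>\<pi>. 3 * real k * last_prob i (\<pi> i) (\<pi> ` {1..i}))"
  proof (rule expectation_mono)
    fix \<pi> assume \<pi>: "\<pi> \<in> set_pmf D"
    define q where "q = last_prob i (\<pi> i) (\<pi> ` {1..i})"
    have q: "q > 0" unfolding q_def last_prob_def
      using prefix_prob_pos[OF \<pi>] joint_prob_pos[OF \<pi>] by simp
    \<comment> \<open>Scaling by \<open>exp 1\<close> before linearising produces the gain
      \<open>2\<close>; the cost \<open>exp 1 * m * q\<close> is then at most
      \<open>3 * k * q\<close>.\<close>
    have "ln (exp 1 * (m * q)) \<le> exp 1 * (m * q) - 1"
      using m q by (intro ln_le_minus_one) simp
    moreover have "ln (exp 1 * (m * q)) = 1 + ln m + ln q" using m q by (simp add: ln_mult)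
    moreover have "exp 1 * (m * q) \<le> 3 * (real k * q)"
      using m q exp_le by (intro mult_mono) auto
    ultimately show "ln (last_prob i (\<pi> i) (\<pi> ` {1..i})) + ln m + 2
        \<le> 3 * real k * last_prob i (\<pi> i) (\<pi> ` {1..i})"
      unfolding q_def[symmetric] by linarith
  qed
  moreover have "E (\<lambda>\<pi>. ln (last_prob i (\<pi> i) (\<pi> ` {1..i})) + ln m + 2)
      = E (\<lambda>\<pi>. ln (last_prob i (\<pi> i) (\<pi> ` {1..i}))) + ln m + 2"
    by simp
  ultimately show ?thesis
    using potential_step[OF i] unfolding m_def hit_prob_def by simp
qed

text \<open>Telescoping downwards from \<open>potential N N = 0\<close>. The window length
  \<open>k\<close> stays fixed as a common bound for the factors \<open>N - i + 1\<close> while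
  \<open>j\<close> grows.\<close>

lemma potential_lower_bound:
  assumes "N \<le> n" "j \<le> k" "j \<le> N"
  shows "2 * real j - 3 * real k * (\<Sum>i\<in>{N-j<..N}. hit_prob i) \<le> potential N (N - j)"
  using assms(2,3)
proof (induction j)
  case 0
  show ?case by (simp add: potential_top)
next
  case (Suc j)
  have "{N - Suc j<..N} = insert (N - j) {N - j<..N}" using Suc.prems by auto
  hence "(\<Sum>i\<in>{N - Suc j<..N}. hit_prob i) = hit_prob (N - j) + (\<Sum>i\<in>{N-j<..N}. hit_prob i)"
    by simp
  moreover have "potential N (N-j) + 2 - 3 * real k * hit_prob (N-j) \<le> potential N (N - j - 1)"
    using Suc.prems assms(1) by (intro potential_step_hit_prob) auto
  ultimately show ?case using Suc by (simp add: algebra_simps)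
qed

section \<open>Two cost functions put into the efficiency hypothesis\<close>

lemma sum_hit_prob_le:
  assumes "backwards_efficient n \<alpha> D"
  shows "(\<Sum>i=1..n. real i * hit_prob i) \<le> \<alpha> * real n"
proof -
  \<comment> \<open>A cost sees only the set, but \<open>card Y\<close> recovers the position
    because a prefix of length \<open>i\<close> has \<open>i\<close> elements.\<close>
  define c where "c = (\<lambda>x Y. real (card Y) * last_prob (card Y) x Y)"
  have "measure_pmf.expectation (pmf_of_set Y) (\<lambda>x. c x Y) \<le> 1" if Y: "Y \<subseteq> {1..n}" "Y \<noteq> {}" for Y
  proof -
    have fin: "finite Y" using Y finite_subset by blast
    hence card: "card Y \<ge> 1" using Y by (simp add: Suc_le_eq card_gt_0_iff)
    have "measure_pmf.expectation (pmf_of_set Y) (\<lambda>x. c x Y) = (\<Sum>x\<in>Y. c x Y) / real (card Y)"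
      using Y fin by (simp add: integral_pmf_of_set)
    also have "\<dots> = (\<Sum>x\<in>Y. joint_prob (card Y) x Y) / prefix_prob (card Y) Y"
      using card by (simp add: c_def last_prob_def sum_divide_distrib)
    \<comment> \<open>The quotient is \<open>1\<close>, or \<open>0\<close> when \<open>Y\<close> is
      never a prefix.\<close>
    also have "\<dots> \<le> 1" using sum_joint_prob[OF fin card] by simp
    finally show ?thesis .
  qed
  hence "E (total_cost n c) \<le> \<alpha> * real n"
    using assms unfolding backwards_efficient_def by blast
  moreover have "E (total_cost n c)
      = E (\<lambda>\<pi>. \<Sum>i=1..n. real i * last_prob i (\<pi> i) (\<pi> ` {1..i}))"
    unfolding total_cost_def c_def
    by (intro integral_cong_AE) (simp_all add: AE_measure_pmf_iff card_prefix del: One_nat_def)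
  ultimately show ?thesis by (simp add: hit_prob_def)
qed

end

text \<open>The constant cost \<open>1\<close> is admissible and has total \<open>n\<close>. The
  bound on \<open>\<alpha>\<close> later ensures that windows are short,
  \<open>48 * k \<le> n\<close>.\<close>

lemma backwards_efficient_imp_ge_1:
  assumes "n \<ge> 1" "backwards_efficient n \<alpha> D"
  shows "\<alpha> \<ge> 1"
proof -
  have "measure_pmf.expectation D (total_cost n (\<lambda>_ _. 1)) \<le> \<alpha> * real n"
    using assms(2) unfolding backwards_efficient_def by simp
  thus ?thesis using assms(1) by (simp add: total_cost_def[abs_def])
qed

theorem theorem1:
  fixes n :: nat and \<alpha> :: real and D :: "(nat \<Rightarrow> nat) pmf"
  assumes "n \<ge> 1" and "\<alpha> > 0"
    and "set_pmf D \<subseteq> {\<pi>. \<pi> permutes {1..n}}"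
    and "backwards_efficient n \<alpha> D"
  shows "perm_entropy n D \<ge> real_of_int \<lfloor>real n / (48 * \<alpha>)\<rfloor>"
proof -
  interpret permutation_pmf n D by unfold_locales (rule assms(3))
  define k where "k = nat \<lfloor>real n / (48 * \<alpha>)\<rfloor>"
  have floor: "real_of_int \<lfloor>real n / (48 * \<alpha>)\<rfloor> = real k"
    using assms(2) by (simp add: k_def)
  show ?thesis
  proof (cases "k \<ge> 1")
    case False
    thus ?thesis using perm_entropy_nonneg floor by simp
  next
    case True
    have "real k \<le> real n / (48 * \<alpha>)" unfolding floor[symmetric] by simp
    hence "real k * (48 * \<alpha>) \<le> real n" using assms(2) by (simp add: field_simps)
    then obtain N where N: "k \<le> N" "N \<le> n" "(\<Sum>i\<in>{N-k<..N}. hit_prob i) \<le> 1 / 3"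
      using exists_light_window[OF hit_prob_nonneg sum_hit_prob_le[OF assms(4)] True _
          backwards_efficient_imp_ge_1[OF assms(1,4)]] by blast
    \<comment> \<open>The threshold \<open>1/3\<close> is matched to the factor \<open>3\<close>: at
      most \<open>k\<close> of the gain \<open>2 * k\<close> is lost.\<close>
    have "3 * real k * (\<Sum>i\<in>{N-k<..N}. hit_prob i) \<le> 3 * real k * (1/3)"
      using N(3) by (intro mult_left_mono) auto
    hence "real k \<le> 2 * real k - 3 * real k * (\<Sum>i\<in>{N-k<..N}. hit_prob i)" by simp
    also have "\<dots> \<le> potential N (N - k)" using N by (intro potential_lower_bound) auto
    also have "\<dots> \<le> perm_entropy n D" by (rule potential_le_perm_entropy) simp
    finally show ?thesis using floor by simp
  qed
qed

end
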